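(* Let $\mathcal A=\mathbb C^2=\mathbb C\varepsilon_1\oplus\mathbb C\varepsilon_2$ with primitive idempotents $\varepsilon_1,\varepsilon_2$, let $\hbar,m>0$, $\gamma\geq0$ real, and on the $4$-cycle with vertices $1,2,3,4$ take symmetric weights $$w_{12}=w_{34}=\gamma\varepsilon_1,\qquad w_{23}=w_{41}=\gamma\varepsilon_2,\qquad w_{13}=w_{24}=0 .$$ Let $\hat T_G=\frac{\hbar^2}{2m}\Delta_w^2$ on $\mathcal A^4$, where $(\Delta_w\Psi)_j=\sum_k w_{jk}(\Psi_j-\Psi_k)$, and set $\kappa=\hbar^2\gamma^2/m$, $\theta=\kappa t/\hbar$, $a(t)=e^{-\mathrm i\theta}\cos\theta$, $b(t)=\mathrm i e^{-\mathrm i\theta}\sin\theta$. Then the solution of the Schr\"odinger equation $\mathrm i\hbar\,\frac{d\Psi}{dt}=\hat T_G\Psi$ with $\Psi_1(0)=1_{\mathcal A}$ and $\Psi_2(0)=\Psi_3(0)=\Psi_4(0)=0$ is $$\Psi_1(t)=a(t)(\varepsilon_1+\varepsilon_2),\qquad \Psi_2(t)=b(t)\varepsilon_1,\qquad \Psi_3(t)=0,\qquad \Psi_4(t)=b(t)\varepsilon_2 .$$ In particular vertex $3$ has zero amplitude for all times.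
   Context: $\mathbb C^2$ carries componentwise multiplication, so $\varepsilon_\alpha\varepsilon_\beta=\delta_{\alpha\beta}\varepsilon_\alpha$ and $\varepsilon_1+\varepsilon_2=1_{\mathcal A}$. $\mathrm i$ is the ordinary imaginary unit acting as a scalar on $\mathcal A$. *)

theory Defs
  imports "HOL-Analysis.Analysis"
begin

text \<open>The multiplication that the library puts on \<open>complex ^ 2\<close> is the componentwise one, with
  unit \<open>1\<close> the constant vector, and \<open>*s\<close> is its complex scalar multiplication.\<close>

type_synonym alg = "complex ^ 2"

definition \<epsilon>\<^sub>1 :: alg where "\<epsilon>\<^sub>1 = axis 1 1"

definition \<epsilon>\<^sub>2 :: alg where "\<epsilon>\<^sub>2 = axis 2 1"

lemma idempotents:
  "\<epsilon>\<^sub>1 * \<epsilon>\<^sub>1 = \<epsilon>\<^sub>1" "\<epsilon>\<^sub>2 * \<epsilon>\<^sub>2 = \<epsilon>\<^sub>2" "\<epsilon>\<^sub>1 * \<epsilon>\<^sub>2 = 0" "\<epsilon>\<^sub>2 * \<epsilon>\<^sub>1 = 0" "\<epsilon>\<^sub>1 + \<epsilon>\<^sub>2 = 1"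
  by (simp_all add: \<epsilon>\<^sub>1_def \<epsilon>\<^sub>2_def axis_def vec_eq_iff forall_2 times_vec_def one_vec_def zero_vec_def)

definition laplacian :: "('n \<Rightarrow> 'n \<Rightarrow> alg) \<Rightarrow> alg ^ 'n \<Rightarrow> alg ^ 'n::finite" where
  "laplacian w \<Psi> = (\<chi> j. \<Sum>k\<in>UNIV. w j k * (\<Psi> $ j - \<Psi> $ k))"

definition kinetic :: "real \<Rightarrow> real \<Rightarrow> ('n \<Rightarrow> 'n \<Rightarrow> alg) \<Rightarrow> alg ^ 'n \<Rightarrow> alg ^ 'n::finite" where
  "kinetic hbar m w \<Psi> = (hbar\<^sup>2 / (2 * m)) *\<^sub>R laplacian w (laplacian w \<Psi>)"

definition schroedinger_solution ::
  "real \<Rightarrow> (alg ^ 'n \<Rightarrow> alg ^ 'n) \<Rightarrow> (real \<Rightarrow> alg ^ 'n::finite) \<Rightarrow> bool" where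
  "schroedinger_solution hbar T \<Psi> \<longleftrightarrow>
     (\<forall>t. \<exists>\<Psi>'. (\<Psi> has_vector_derivative \<Psi>') (at t) \<and>
          (\<chi> j. (\<i> * complex_of_real hbar) *s (\<Psi>' $ j)) = T (\<Psi> t))"

end

theory Submission
  imports Defs
begin

text \<open>The weights on \<open>\<epsilon>\<^sub>1\<close> and \<open>\<epsilon>\<^sub>2\<close> are the two perfect matchings of the cycle, so each
  idempotent component of the equation decouples into independent two-vertex systems
  \<open>f' = -\<i>c(f - g)\<close>, \<open>g' = -\<i>c(g - f)\<close>. In such a system \<open>f + g\<close> and \<open>e\<^sup>2\<^sup>\<i>\<^sup>c\<^sup>t (f - g)\<close> are
  conserved. Vertex 3 is matched to a vertex with zero initial amplitude in both components.\<close>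

lemma has_vector_derivative_vec_iff:
  fixes f :: "real \<Rightarrow> 'a::real_normed_vector ^ 'n::finite"
  shows "(f has_vector_derivative f') (at t within S) \<longleftrightarrow>
    (\<forall>i. ((\<lambda>t. f t $ i) has_vector_derivative f' $ i) (at t within S))"
proof
  assume "(f has_vector_derivative f') (at t within S)"
  then show "\<forall>i. ((\<lambda>t. f t $ i) has_vector_derivative f' $ i) (at t within S)"
    using bounded_linear.has_vector_derivative[OF bounded_linear_vec_nth] by blast
next
  assume "\<forall>i. ((\<lambda>t. f t $ i) has_vector_derivative f' $ i) (at t within S)"
  then show "(f has_vector_derivative f') (at t within S)"
    \<comment> \<open>The normalized remainder is itself a vector, so its limit can be checked one
      coordinate at a time.\<close>
    unfolding has_vector_derivative_def has_derivative_def
    by (auto intro!: vec_tendstoI bounded_linear_scaleR_left)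
qed

lemma has_vector_derivative_zero_imp_eq:
  fixes f :: "real \<Rightarrow> 'a::real_normed_vector"
  assumes "\<And>t. (f has_vector_derivative 0) (at t)"
  shows "f t = f 0"
proof -
  obtain c where "\<And>t. t \<in> UNIV \<Longrightarrow> f t = c"
    using has_vector_derivative_zero_constant[of UNIV f] assms by auto
  then show ?thesis by simp
qed

lemma exp_phase_derivative:
  fixes k :: complex
  shows "((\<lambda>t. exp (k * of_real t)) has_vector_derivative k * exp (k * of_real t)) (at t)"
proof -
  have "((\<lambda>z. exp (k * z)) has_field_derivative k * exp (k * of_real t)) (at (of_real t))"
    by (auto intro!: derivative_eq_intros)
  then show ?thesis
    using has_vector_derivative_real_field by blast
qed

text \<open>As an equivalence this covers both uniqueness (left to right) and verification (right to
  left). The sum and difference of \<open>f\<close> and \<open>g\<close> are the normal modes, with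
  frequencies 0 and \<open>2 * c\<close>; the common phase \<open>E\<close> has the mean frequency
  \<open>c\<close>, which leaves a cosine and a sine.\<close>

lemma two_vertex_system_iff:
  fixes f g :: "real \<Rightarrow> complex" and c :: real and x y :: complex
  defines "E \<equiv> \<lambda>t. exp (- \<i> * complex_of_real (c * t))"
  shows "((\<forall>t. (f has_vector_derivative - \<i> * c * (f t - g t)) (at t)) \<and>
          (\<forall>t. (g has_vector_derivative - \<i> * c * (g t - f t)) (at t)) \<and> f 0 = x \<and> g 0 = y) \<longleftrightarrow>
    (\<forall>t. f t = E t * cos (c * t) * x + \<i> * E t * sin (c * t) * y) \<and>
    (\<forall>t. g t = \<i> * E t * sin (c * t) * x + E t * cos (c * t) * y)"
    (is "?L \<longleftrightarrow> ?R")
proof -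
  \<comment> \<open>The phase of the antisymmetric mode, equal to the square of
    \<open>E\<close>.\<close>
  define F where "F \<equiv> \<lambda>t. exp ((- 2 * \<i> * c) * complex_of_real t)"
  have F0: "F 0 = 1" by (simp add: F_def)
  have cosE: "E t * cos (c * t) = (1 + F t) / 2" and sinE: "\<i> * E t * sin (c * t) = (1 - F t) / 2"
    for t
  proof -
    have E_exp: "E t * exp (\<i> * (c * t)) = 1" "E t * E t = F t"
      by (simp_all add: E_def F_def mult.assoc flip: exp_add)
    \<comment> \<open>Euler's formula, with \<open>E t\<close> as the inverse of the positive
      exponential: multiplying by \<open>E t\<close> turns the two exponentials into 1 and
      \<open>F t\<close>.\<close>
    have cos: "complex_of_real (cos (c * t)) = (exp (\<i> * (c * t)) + E t) / 2"
      and sin: "\<i> * complex_of_real (sin (c * t)) = (exp (\<i> * (c * t)) - E t) / 2"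
      by (simp_all add: E_def exp_Euler exp_minus_Euler flip: cos_of_real sin_of_real)
    show "E t * cos (c * t) = (1 + F t) / 2"
      unfolding cos by (simp only: distrib_left E_exp times_divide_eq_right)
    have "\<i> * E t * sin (c * t) = E t * (\<i> * sin (c * t))"
      by simp
    also have "\<dots> = (1 - F t) / 2"
      unfolding sin by (simp only: right_diff_distrib E_exp times_divide_eq_right)
    finally show "\<i> * E t * sin (c * t) = (1 - F t) / 2" .
  qed
  have split: "(1 + p) / 2 * x + (1 - p) / 2 * y = (x + y) / 2 + p * ((x - y) / 2)"
    "(1 - p) / 2 * x + (1 + p) / 2 * y = (x + y) / 2 - p * ((x - y) / 2)" for p
    by (simp_all add: field_simps)
  have R: "?R \<longleftrightarrow> (\<forall>t. f t = (x + y) / 2 + F t * ((x - y) / 2)) \<and>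
      (\<forall>t. g t = (x + y) / 2 - F t * ((x - y) / 2))"
    by (simp only: cosE sinE split)
  show ?thesis
  proof
    assume L: ?L
    \<comment> \<open>The integrating factor for the difference, namely the inverse of
      \<open>F\<close>.\<close>
    define G where "G \<equiv> \<lambda>t. exp ((2 * \<i> * c) * complex_of_real t)"
    have GF: "G t * F t = 1" for t
      by (simp add: G_def F_def flip: exp_add)
    have "((\<lambda>t. f t + g t) has_vector_derivative 0) (at t)" for t
    proof -
      have "((\<lambda>t. f t + g t) has_vector_derivative
          - \<i> * c * (f t - g t) + - \<i> * c * (g t - f t)) (at t)"
        using L by (intro has_vector_derivative_add) auto
      then show ?thesis by (simp add: algebra_simps)
    qed
    from has_vector_derivative_zero_imp_eq[OF this] have sum: "f t + g t = x + y" for t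
      using L by simp
    have "((\<lambda>t. G t * (f t - g t)) has_vector_derivative 0) (at t)" for t
    proof -
      \<comment> \<open>By the product rule the growth of \<open>G\<close> contributes
        \<open>2 * \<i> * c\<close>, which cancels the rate \<open>- 2 * \<i> * c\<close> of the
        difference.\<close>
      have "((\<lambda>t. G t * (f t - g t)) has_vector_derivative
          G t * (- \<i> * c * (f t - g t) - - \<i> * c * (g t - f t)) +
          (2 * \<i> * c) * G t * (f t - g t)) (at t)"
        unfolding G_def
        using L by (intro has_vector_derivative_mult has_vector_derivative_diff
            exp_phase_derivative) auto
      then show ?thesis by (simp add: algebra_simps)
    qed
    from has_vector_derivative_zero_imp_eq[OF this] have "G t * (f t - g t) = x - y" for t
      using L by (simp add: G_def)
    then have diff: "f t - g t = F t * (x - y)" for t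
      using GF[of t] by (metis mult.assoc mult.commute mult_1)
    have "f t = ((f t + g t) + (f t - g t)) / 2" "g t = ((f t + g t) - (f t - g t)) / 2" for t
      by simp_all
    then show ?R
      unfolding R sum diff by (simp add: add_divide_distrib diff_divide_distrib)
  next
    assume ?R
    then have f: "f = (\<lambda>t. (x + y) / 2 + F t * ((x - y) / 2))"
      and g: "g = (\<lambda>t. (x + y) / 2 - F t * ((x - y) / 2))"
      unfolding R by auto
    have F': "((\<lambda>t. F t * z) has_vector_derivative - 2 * \<i> * c * F t * z) (at t)" for t z
      unfolding F_def by (intro has_vector_derivative_mult_left exp_phase_derivative)
    show ?L
    proof (intro conjI allI)
      fix t
      have "(f has_vector_derivative 0 + - 2 * \<i> * c * F t * ((x - y) / 2)) (at t)"
        unfolding f by (intro has_vector_derivative_add has_vector_derivative_const F')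
      moreover have "0 + - 2 * \<i> * c * F t * ((x - y) / 2) = - \<i> * c * (f t - g t)"
        by (simp add: f g field_simps)
      ultimately show "(f has_vector_derivative - \<i> * c * (f t - g t)) (at t)"
        by (simp only:)
      have "(g has_vector_derivative 0 - - 2 * \<i> * c * F t * ((x - y) / 2)) (at t)"
        unfolding g by (intro has_vector_derivative_diff has_vector_derivative_const F')
      moreover have "0 - - 2 * \<i> * c * F t * ((x - y) / 2) = - \<i> * c * (g t - f t)"
        by (simp add: f g field_simps)
      ultimately show "(g has_vector_derivative - \<i> * c * (g t - f t)) (at t)"
        by (simp only:)
    qed (simp_all add: f g F0 field_simps)
  qed
qed

text \<open>For nonzero \<open>hbar\<close> the factor \<open>\<i> * hbar\<close> can be divided
  out, which determines the derivative. Differentiability then passes to coordinates twice, over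
  vertices and over the two factors of the algebra.\<close>

lemma schroedinger_solution_iff_components:
  assumes "hbar \<noteq> 0"
  shows "schroedinger_solution hbar T \<Psi> \<longleftrightarrow>
    (\<forall>j k t. ((\<lambda>t. \<Psi> t $ j $ k) has_vector_derivative T (\<Psi> t) $ j $ k / (\<i> * hbar)) (at t))"
proof -
  have eq: "(\<chi> j. (\<i> * complex_of_real hbar) *s (\<Psi>' $ j)) = X \<longleftrightarrow>
      \<Psi>' = (\<chi> j k. X $ j $ k / (\<i> * hbar))" for \<Psi>' X :: "alg ^ 'n"
    using assms by (auto simp: vec_eq_iff field_simps)
  show ?thesis
    unfolding schroedinger_solution_def eq by (auto simp: has_vector_derivative_vec_iff)
qed

theorem mainTheorem14:
  fixes hbar m \<gamma> \<kappa> :: real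
    and w :: "4 \<Rightarrow> 4 \<Rightarrow> alg"
    and \<theta> :: "real \<Rightarrow> real"
    and a b :: "real \<Rightarrow> complex"
    and \<Psi> :: "real \<Rightarrow> alg ^ 4"
  assumes "hbar > 0" "m > 0" "\<gamma> \<ge> 0"
    and w_sym: "\<And>j k. w j k = w k j"
    and "w 1 2 = \<gamma> *\<^sub>R \<epsilon>\<^sub>1" "w 3 4 = \<gamma> *\<^sub>R \<epsilon>\<^sub>1"
    and "w 2 3 = \<gamma> *\<^sub>R \<epsilon>\<^sub>2" "w 4 1 = \<gamma> *\<^sub>R \<epsilon>\<^sub>2"
    and "w 1 3 = 0" "w 2 4 = 0"
    and \<kappa>: "\<kappa> = hbar\<^sup>2 * \<gamma>\<^sup>2 / m"
    and \<theta>: "\<And>t. \<theta> t = \<kappa> * t / hbar"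
    and a: "\<And>t. a t = exp (- \<i> * complex_of_real (\<theta> t)) * complex_of_real (cos (\<theta> t))"
    and b: "\<And>t. b t = \<i> * exp (- \<i> * complex_of_real (\<theta> t)) * complex_of_real (sin (\<theta> t))"
  shows "((schroedinger_solution hbar (kinetic hbar m w) \<Psi> \<and>
            \<Psi> 0 $ 1 = 1 \<and> \<Psi> 0 $ 2 = 0 \<and> \<Psi> 0 $ 3 = 0 \<and> \<Psi> 0 $ 4 = 0) \<longleftrightarrow>
          (\<forall>t. \<Psi> t $ 1 = a t *s (\<epsilon>\<^sub>1 + \<epsilon>\<^sub>2) \<and> \<Psi> t $ 2 = b t *s \<epsilon>\<^sub>1 \<and>
               \<Psi> t $ 3 = 0 \<and> \<Psi> t $ 4 = b t *s \<epsilon>\<^sub>2)) \<and>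
         ((schroedinger_solution hbar (kinetic hbar m w) \<Psi> \<and>
            \<Psi> 0 $ 1 = 1 \<and> \<Psi> 0 $ 2 = 0 \<and> \<Psi> 0 $ 3 = 0 \<and> \<Psi> 0 $ 4 = 0) \<longrightarrow>
          (\<forall>t. \<Psi> t $ 3 = 0))"
proof -
  have w: "w 2 1 = \<gamma> *\<^sub>R \<epsilon>\<^sub>1" "w 4 3 = \<gamma> *\<^sub>R \<epsilon>\<^sub>1" "w 3 2 = \<gamma> *\<^sub>R \<epsilon>\<^sub>2"
    "w 1 4 = \<gamma> *\<^sub>R \<epsilon>\<^sub>2" "w 3 1 = 0" "w 4 2 = 0"
    using assms w_sym by metis+
  have \<epsilon>: "\<epsilon>\<^sub>1 $ 1 = 1" "\<epsilon>\<^sub>1 $ 2 = 0" "\<epsilon>\<^sub>2 $ 1 = 0" "\<epsilon>\<^sub>2 $ 2 = 1"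
    by (simp_all add: \<epsilon>\<^sub>1_def \<epsilon>\<^sub>2_def axis_def)
  define \<omega> where "\<omega> = \<kappa> / hbar"
  have \<theta>\<omega>: "\<theta> t = \<omega> * t" for t
    by (simp add: \<theta> \<omega>_def)
  have laplacian_nth: "laplacian w X $ j $ k = (\<Sum>i\<in>UNIV. w j i $ k * (X $ j $ k - X $ i $ k))" for X j k
    by (simp add: laplacian_def)
  let ?L = "laplacian w"
  \<comment> \<open>In either component every vertex keeps exactly one neighbour. Diagonal terms
    vanish whatever \<open>w j j\<close> is, since they multiply
    \<open>X $ j - X $ j\<close>.\<close>
  have L: "?L X $ 1 $ 1 = \<gamma> * (X $ 1 $ 1 - X $ 2 $ 1)" "?L X $ 2 $ 1 = \<gamma> * (X $ 2 $ 1 - X $ 1 $ 1)"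
    "?L X $ 3 $ 1 = \<gamma> * (X $ 3 $ 1 - X $ 4 $ 1)" "?L X $ 4 $ 1 = \<gamma> * (X $ 4 $ 1 - X $ 3 $ 1)"
    "?L X $ 1 $ 2 = \<gamma> * (X $ 1 $ 2 - X $ 4 $ 2)" "?L X $ 4 $ 2 = \<gamma> * (X $ 4 $ 2 - X $ 1 $ 2)"
    "?L X $ 2 $ 2 = \<gamma> * (X $ 2 $ 2 - X $ 3 $ 2)" "?L X $ 3 $ 2 = \<gamma> * (X $ 3 $ 2 - X $ 2 $ 2)" for X
    unfolding laplacian_nth sum_4 assms(5-10) w vector_scaleR_component \<epsilon>
    by (simp_all add: scaleR_conv_of_real)
  let ?T = "\<lambda>X j k. kinetic hbar m w X $ j $ k / (\<i> * hbar)"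
  \<comment> \<open>Applying the edge Laplacian twice gives
    \<open>2 * \<gamma>\<^sup>2 * (x - y)\<close>. The 2 cancels against \<open>2 * m\<close>, and
    division by \<open>\<i> * hbar\<close> leaves \<open>- \<i>\<close> times
    \<open>\<kappa> / hbar\<close>.\<close>
  have T_pair: "(hbar\<^sup>2 / (2 * m)) *\<^sub>R (\<gamma> * (\<gamma> * (x - y) - \<gamma> * (y - x))) / (\<i> * hbar)
      = - \<i> * \<omega> * (x - y)" for x y :: complex
    using \<open>hbar > 0\<close> \<open>m > 0\<close>
    by (simp add: \<omega>_def \<kappa> scaleR_conv_of_real field_simps power2_eq_square)
  have T: "?T X 1 1 = - \<i> * \<omega> * (X $ 1 $ 1 - X $ 2 $ 1)" "?T X 2 1 = - \<i> * \<omega> * (X $ 2 $ 1 - X $ 1 $ 1)"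
    "?T X 3 1 = - \<i> * \<omega> * (X $ 3 $ 1 - X $ 4 $ 1)" "?T X 4 1 = - \<i> * \<omega> * (X $ 4 $ 1 - X $ 3 $ 1)"
    "?T X 1 2 = - \<i> * \<omega> * (X $ 1 $ 2 - X $ 4 $ 2)" "?T X 4 2 = - \<i> * \<omega> * (X $ 4 $ 2 - X $ 1 $ 2)"
    "?T X 2 2 = - \<i> * \<omega> * (X $ 2 $ 2 - X $ 3 $ 2)" "?T X 3 2 = - \<i> * \<omega> * (X $ 3 $ 2 - X $ 2 $ 2)" for X
    unfolding kinetic_def vector_scaleR_component L by (rule T_pair)+
  let ?P = "\<lambda>j k x. \<Psi> 0 $ j $ k = x"
  let ?D = "\<lambda>j k j'. \<forall>t. ((\<lambda>t. \<Psi> t $ j $ k) has_vector_derivative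
      - \<i> * \<omega> * (\<Psi> t $ j $ k - \<Psi> t $ j' $ k)) (at t)"
  \<comment> \<open>The eight scalar equations are grouped by matched edges: 12 and 34 in the first
    component, 14 and 23 in the second.\<close>
  have S: "schroedinger_solution hbar (kinetic hbar m w) \<Psi> \<longleftrightarrow>
     (?D 1 1 2 \<and> ?D 2 1 1) \<and> (?D 3 1 4 \<and> ?D 4 1 3) \<and> (?D 1 2 4 \<and> ?D 4 2 1) \<and> (?D 2 2 3 \<and> ?D 3 2 2)"
    using \<open>hbar > 0\<close>
    by (subst schroedinger_solution_iff_components) (auto simp only: forall_4 forall_2 T)
  \<comment> \<open>The two-vertex solution with only the first vertex excited: it keeps amplitude
    \<open>a\<close>, and its partner receives \<open>b\<close>.\<close>
  have pair: "?D j k j' \<and> ?D j' k j \<and> ?P j k x \<and> ?P j' k 0 \<longleftrightarrow>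
      (\<forall>t. \<Psi> t $ j $ k = a t * x) \<and> (\<forall>t. \<Psi> t $ j' $ k = b t * x)" for j k j' x
    using two_vertex_system_iff[of "\<lambda>t. \<Psi> t $ j $ k" \<omega> "\<lambda>t. \<Psi> t $ j' $ k" x 0]
    by (simp add: a b \<theta>\<omega>)
  have "schroedinger_solution hbar (kinetic hbar m w) \<Psi> \<and>
      \<Psi> 0 $ 1 = 1 \<and> \<Psi> 0 $ 2 = 0 \<and> \<Psi> 0 $ 3 = 0 \<and> \<Psi> 0 $ 4 = 0 \<longleftrightarrow>
     (?D 1 1 2 \<and> ?D 2 1 1 \<and> ?P 1 1 1 \<and> ?P 2 1 0) \<and> (?D 3 1 4 \<and> ?D 4 1 3 \<and> ?P 3 1 0 \<and> ?P 4 1 0) \<and>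
     (?D 1 2 4 \<and> ?D 4 2 1 \<and> ?P 1 2 1 \<and> ?P 4 2 0) \<and> (?D 2 2 3 \<and> ?D 3 2 2 \<and> ?P 2 2 0 \<and> ?P 3 2 0)"
    unfolding S vec_eq_iff[where 'b = 2] forall_2 zero_index one_index by blast
  also have "\<dots> \<longleftrightarrow> (\<forall>t. \<Psi> t $ 1 = a t *s (\<epsilon>\<^sub>1 + \<epsilon>\<^sub>2) \<and> \<Psi> t $ 2 = b t *s \<epsilon>\<^sub>1 \<and>
      \<Psi> t $ 3 = 0 \<and> \<Psi> t $ 4 = b t *s \<epsilon>\<^sub>2)"
    \<comment> \<open>Here \<open>x\<close> is 1 for the two pairs led by vertex 1 and 0 for the
      other two. Vertex 3 lies only in the latter, so both its components vanish.\<close>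
    unfolding pair by (auto simp: vec_eq_iff[where 'b = 2] forall_2 \<epsilon>)
  finally show ?thesis by blast
qed

end
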